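(* Fix $j\in\mathbb N$ and write $\phi=\phi_j$, $\lambda=\lambda_j$. The function $x\mapsto x^{-1}\phi(x)$ is Lebesgue integrable on $[0,1]$; put $\Phi_1=\int_0^1\frac{\phi(y)}{y}\,dy\in\mathbb R$. If $0<x<1$ and $1/x$ is not an integer, then $\phi$ is differentiable at $x$ and $$\lambda^{-1}x^2\phi'(x)=\Phi_1-\sum_{m>1/x}\frac{\phi\left(\frac{1}{mx}\right)}{m}\in\mathbb R,$$ the sum being over integers $m>1/x$. Moreover, for each $n\in\mathbb N$, the derivative $\phi'$ is continuous on the open interval $\left(\frac1{n+1},\frac1n\right)$, and $$\lim_{x\to\frac1n-}\phi'(x)=\lambda n^2\Big(\Phi_1-\sum_{m=n+1}^\infty\frac{\phi(n/m)}{m}\Big)\in\mathbb R,\qquad \lim_{x\to\frac1{n+1}+}\phi'(x)=\lambda (n+1)^2\Big(\Phi_1-\sum_{m=n+1}^\infty\frac{\phi((n+1)/m)}{m}\Big)\in\mathbb R.$$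
   Context: Let $K:[0,1]\times[0,1]\to\mathbb R$ be defined by $K(x,y)=\frac12-\{(xy)^{-1}\}$ if $0<x,y\le 1$, and $K(x,y)=0$ if $0\le x,y\le1$ and $xy=0$, where $\{\alpha\}=\alpha-\lfloor\alpha\rfloor$. Let $L^2([0,1])$ denote the space of real-valued Lebesgue measurable square-integrable functions on $[0,1]$, with $\langle f,g\rangle=\int_0^1 f(x)g(x)\,dx$ and $\|f\|=\langle f,f\rangle^{1/2}$. A function $\phi$ is an eigenfunction of $K$ (with eigenvalue $\lambda\in\mathbb R$) if $\phi\in L^2([0,1])$, $\|\phi\|>0$, and $\phi(x)=\lambda\int_0^1 K(x,y)\phi(y)\,dy$ for every $x\in[0,1]$. Let $\phi_1,\phi_2,\ldots$ be a maximal orthonormal system in $L^2([0,1])$ of eigenfunctions of $K$, $\phi_j$ having the nonzero real eigenvalue $\lambda_j$, numbered so that $0<|\lambda_1|\le|\lambda_2|\le\cdots$ and $\lambda_j\ge\lambda_{j+1}$ whenever $|\lambda_j|=|\lambda_{j+1}|$. *)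

theory Defs
  imports "HOL-Analysis.Analysis"
begin

definition kerK :: "real \<Rightarrow> real \<Rightarrow> real" where
  "kerK x y = (if x * y = 0 then 0 else 1/2 - frac (1 / (x * y)))"

definition L2 :: "(real \<Rightarrow> real) \<Rightarrow> bool" where
  "L2 f \<longleftrightarrow> set_borel_measurable lebesgue {0..1} f
            \<and> set_integrable lebesgue {0..1} (\<lambda>x. (f x)\<^sup>2)"

definition inner01 :: "(real \<Rightarrow> real) \<Rightarrow> (real \<Rightarrow> real) \<Rightarrow> real" where
  "inner01 f g = (LINT x:{0..1}|lebesgue. f x * g x)"

definition norm01 :: "(real \<Rightarrow> real) \<Rightarrow> real" where
  "norm01 f = sqrt (inner01 f f)"

definition eigenfun :: "(real \<Rightarrow> real) \<Rightarrow> real \<Rightarrow> bool" where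
  "eigenfun phi lam \<longleftrightarrow> L2 phi \<and> norm01 phi > 0 \<and>
     (\<forall>x\<in>{0..1}. phi x = lam * (LINT y:{0..1}|lebesgue. kerK x y * phi y))"

definition eigen_system :: "(nat \<Rightarrow> real \<Rightarrow> real) \<Rightarrow> (nat \<Rightarrow> real) \<Rightarrow> bool" where
  "eigen_system phi lam \<longleftrightarrow>
     (\<forall>j\<ge>1. lam j \<noteq> 0 \<and> eigenfun (phi j) (lam j)) \<and>
     (\<forall>i\<ge>1. \<forall>k\<ge>1. inner01 (phi i) (phi k) = (if i = k then 1 else 0)) \<and>
     (\<forall>psi mu. eigenfun psi mu \<and> mu \<noteq> 0 \<longrightarrow> (\<exists>i\<ge>1. inner01 psi (phi i) \<noteq> 0)) \<and>
     (\<forall>j\<ge>1. 0 < \<bar>lam j\<bar> \<and> \<bar>lam j\<bar> \<le> \<bar>lam (Suc j)\<bar>) \<and>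
     (\<forall>j\<ge>1. \<bar>lam j\<bar> = \<bar>lam (Suc j)\<bar> \<longrightarrow> lam j \<ge> lam (Suc j))"

end

theory Submission
  imports Defs
begin

text \<open>
  Up to a factor \<open>- x\<close>, the quotient \<open>K(x, z) / z\<^sup>2\<close> is the derivative of a bounded primitive of
  the sawtooth evaluated at \<open>1 / (x z)\<close>, so \<open>K(x, \<cdot>)\<close> has integrals \<open>O(x)\<close> over all subintervals
  of \<open>(0, 1]\<close>. As \<open>K(\<cdot>, y)\<close> is a sum of two monotone functions, the second mean value theorem
  bounds the iterated kernel by \<open>O(sqrt (x / y))\<close>. Applying the eigenvalue equation twice gives
  \<open>\<phi>(x) = O(sqrt x)\<close>, whence \<open>\<phi>(y) / y\<close> is integrable and all series in the theorem converge
  uniformly. With \<open>\<Psi>(t) = \<integral>\<^sub>0\<^sup>t \<phi>\<close>, writing the floor in the kernel as a sum of indicator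
  functions yields
  \<open>\<phi>(x) / \<lambda> = \<Psi>(1) / 2 - \<Phi>\<^sub>1 / x + \<Sum>m\<ge>1. \<Psi>(min 1 (1 / (m x)))\<close>,
  which is differentiated term by term on each interval \<open>(1 / (n + 1), 1 / n)\<close>.
\<close>

section \<open>Oscillatory integrals with monotone weights\<close>

lemma
  fixes f g :: "real \<Rightarrow> real"
  assumes f: "f integrable_on {a..b}" and "a \<le> b"
    and bound: "\<And>c d. \<lbrakk>a \<le> c; c \<le> d; d \<le> b\<rbrakk> \<Longrightarrow> \<bar>integral {c..d} f\<bar> \<le> B"
    and g: "mono_on {a..b} g"
  shows integrable_on_mono_weight: "(\<lambda>x. g x * f x) integrable_on {a..b}"
    and abs_integral_mono_weight_le: "\<bar>integral {a..b} (\<lambda>x. g x * f x)\<bar> \<le> B * (\<bar>g a\<bar> + \<bar>g b\<bar>)"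
proof -
  obtain c where c: "a \<le> c" "c \<le> b"
    and mean_value: "((\<lambda>x. g x * f x) has_integral
      g a * integral {a..c} f + g b * integral {c..b} f) {a..b}"
    using second_mean_value_theorem_full[OF f \<open>a \<le> b\<close>, of g] g by (force simp: mono_on_def)
  then show "(\<lambda>x. g x * f x) integrable_on {a..b}"
    by blast
  have "\<bar>g a * integral {a..c} f + g b * integral {c..b} f\<bar>
      \<le> \<bar>g a\<bar> * \<bar>integral {a..c} f\<bar> + \<bar>g b\<bar> * \<bar>integral {c..b} f\<bar>"
    by (metis abs_mult abs_triangle_ineq)
  also have "\<dots> \<le> \<bar>g a\<bar> * B + \<bar>g b\<bar> * B"
    using c by (intro add_mono mult_left_mono bound) auto
  finally show "\<bar>integral {a..b} (\<lambda>x. g x * f x)\<bar> \<le> B * (\<bar>g a\<bar> + \<bar>g b\<bar>)"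
    unfolding integral_unique[OF mean_value] by (simp add: algebra_simps)
qed

lemma abs_integral_mono_plus_antimono_weight_le:
  fixes f g h :: "real \<Rightarrow> real"
  assumes f: "f integrable_on {a..b}" and "a \<le> b"
    and bound: "\<And>c d. \<lbrakk>a \<le> c; c \<le> d; d \<le> b\<rbrakk> \<Longrightarrow> \<bar>integral {c..d} f\<bar> \<le> B"
    and g: "mono_on {a..b} g" and h: "antimono_on {a..b} h"
  shows "\<bar>integral {a..b} (\<lambda>x. (g x + h x) * f x)\<bar> \<le> B * (\<bar>g a\<bar> + \<bar>g b\<bar> + \<bar>h a\<bar> + \<bar>h b\<bar>)"
proof -
  have minus_h: "mono_on {a..b} (\<lambda>x. - h x)"
    using h by (simp add: monotone_on_def)
  have "integral {a..b} (\<lambda>x. (g x + h x) * f x) = integral {a..b} (\<lambda>x. g x * f x - - h x * f x)"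
    by (simp add: algebra_simps)
  also have "\<dots> = integral {a..b} (\<lambda>x. g x * f x) - integral {a..b} (\<lambda>x. - h x * f x)"
    using integrable_on_mono_weight[OF f \<open>a \<le> b\<close> bound g]
      integrable_on_mono_weight[OF f \<open>a \<le> b\<close> bound minus_h]
    by (rule Henstock_Kurzweil_Integration.integral_diff)
  also have "\<bar>\<dots>\<bar> \<le> B * (\<bar>g a\<bar> + \<bar>g b\<bar>) + B * (\<bar>- h a\<bar> + \<bar>- h b\<bar>)"
    using abs_integral_mono_weight_le[OF f \<open>a \<le> b\<close> bound g]
      abs_integral_mono_weight_le[OF f \<open>a \<le> b\<close> bound minus_h]
    by (rule order_trans[OF abs_triangle_ineq4 add_mono])
  finally show ?thesis
    by (simp add: algebra_simps)
qed

definition sawtooth_primitive :: "real \<Rightarrow> real" where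
  "sawtooth_primitive t = frac t * (1 - frac t) / 2"

lemma sawtooth_primitive_bounds: "0 \<le> sawtooth_primitive t" "sawtooth_primitive t \<le> 1/8"
proof -
  have "0 \<le> frac t * (1 - frac t)"
    using frac_lt_1[of t] by (intro mult_nonneg_nonneg) auto
  then show "0 \<le> sawtooth_primitive t"
    by (simp add: sawtooth_primitive_def)
  have "0 \<le> (frac t - 1/2)\<^sup>2"
    by simp
  then show "sawtooth_primitive t \<le> 1/8"
    by (simp add: sawtooth_primitive_def power2_eq_square algebra_simps)
qed

lemma sawtooth_primitive_le_dist_int: "sawtooth_primitive t \<le> \<bar>t - of_int n\<bar> / 2"
proof (cases "of_int n \<le> t")
  case True
  then have "frac t \<le> t - of_int n"
    by (simp add: frac_def le_floor_iff)
  moreover have "frac t * (1 - frac t) \<le> frac t"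
    by (simp add: mult_left_le)
  ultimately show ?thesis
    by (simp add: sawtooth_primitive_def)
next
  case False
  then have "\<lfloor>t\<rfloor> < n"
    by (simp add: floor_less_iff)
  then have "1 - frac t \<le> of_int n - t"
    unfolding frac_def by linarith
  moreover have "frac t * (1 - frac t) \<le> 1 - frac t"
    using frac_lt_1[of t] by (simp add: mult_left_le_one_le)
  ultimately show ?thesis
    by (simp add: sawtooth_primitive_def)
qed

lemma sawtooth_primitive_has_real_derivative:
  assumes "t \<notin> \<int>"
  shows "(sawtooth_primitive has_real_derivative 1/2 - frac t) (at t)"
proof -
  have "(frac has_real_derivative 1) (at t)"
    unfolding frac_def[abs_def] using assms
    by (auto intro!: derivative_eq_intros floor_has_real_derivative[where f = "\<lambda>s. s"])
  then show ?thesis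
    unfolding sawtooth_primitive_def[abs_def]
    by (auto intro!: derivative_eq_intros simp: field_simps)
qed

lemma isCont_sawtooth_primitive: "isCont sawtooth_primitive t"
proof (cases "t \<in> \<int>")
  case True
  then obtain n :: int where n: "t = of_int n"
    by (auto elim: Ints_cases)
  have "(sawtooth_primitive \<longlongrightarrow> 0) (at t)"
  proof (rule Lim_null_comparison)
    show "\<forall>\<^sub>F s in at t. norm (sawtooth_primitive s) \<le> \<bar>s - t\<bar> / 2"
      using sawtooth_primitive_bounds sawtooth_primitive_le_dist_int[of _ n]
      by (intro always_eventually) (simp add: n)
    show "((\<lambda>s. \<bar>s - t\<bar> / 2) \<longlongrightarrow> 0) (at t)"
      by (auto intro!: tendsto_eq_intros)
  qed
  moreover have "sawtooth_primitive t = 0"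
    by (simp add: sawtooth_primitive_def n)
  ultimately show ?thesis
    by (simp add: isCont_def)
next
  case False
  then show ?thesis
    using sawtooth_primitive_has_real_derivative by (blast intro: DERIV_isCont)
qed

section \<open>The kernel and its iterate\<close>

lemma kerK_0_right [simp]: "kerK x 0 = 0"
  by (simp add: kerK_def)

lemma abs_kerK_le: "\<bar>kerK x y\<bar> \<le> 1/2"
  using frac_lt_1[of "1 / (x * y)"] frac_ge_0[of "1 / (x * y)"]
  unfolding kerK_def by (simp only: abs_le_iff split: if_split) linarith

lemma abs_kerK_mult_le: "\<bar>kerK x y * c\<bar> \<le> \<bar>c\<bar>"
  using mult_right_mono[OF abs_kerK_le[of x y], of "\<bar>c\<bar>"] by (simp add: abs_mult)

lemma borel_measurable_kerK [measurable (raw)]: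
  assumes [measurable]: "f \<in> borel_measurable M" "g \<in> borel_measurable M"
  shows "(\<lambda>x. kerK (f x) (g x)) \<in> borel_measurable M"
  unfolding kerK_def frac_def by measurable

lemma kerK_eq_floor:
  assumes "x * y \<noteq> 0"
  shows "kerK x y = 1/2 - 1 / (x * y) + of_int \<lfloor>1 / (x * y)\<rfloor>"
  using assms by (simp add: kerK_def frac_def)

lemma reciprocal_IntsE:
  fixes x z :: real
  assumes "1 / (x * z) \<in> \<int>" "x \<noteq> 0"
  obtains i :: int where "1 / (x * z) = of_int i" "z = 1 / (x * of_int i)"
proof -
  obtain i :: int where i: "1 / (x * z) = of_int i"
    using assms(1) by (auto elim: Ints_cases)
  have "z = 1 / (x * of_int i)"
    unfolding i[symmetric] using assms(2) by simp
  with i show ?thesis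
    by (rule that)
qed

lemma finite_reciprocal_Ints:
  assumes "0 < x" "0 < a"
  shows "finite {z::real. a \<le> z \<and> 1 / (x * z) \<in> \<int>}"
proof (rule finite_subset)
  let ?points = "(\<lambda>i::int. 1 / (x * of_int i)) ` {0..\<lfloor>1 / (x * a)\<rfloor>}"
  show "{z. a \<le> z \<and> 1 / (x * z) \<in> \<int>} \<subseteq> ?points"
  proof clarify
    fix z assume z: "a \<le> z" "1 / (x * z) \<in> \<int>"
    obtain i :: int where i: "1 / (x * z) = of_int i" "z = 1 / (x * of_int i)"
      using z(2) assms(1) by (auto elim: reciprocal_IntsE)
    have "of_int i \<le> 1 / (x * a)" "(0::real) \<le> of_int i"
      unfolding i(1)[symmetric] using assms z by (auto intro!: divide_left_mono mult_left_mono)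
    then have "i \<in> {0..\<lfloor>1 / (x * a)\<rfloor>}"
      by (simp add: le_floor_iff)
    with i(2) show "z \<in> ?points"
      by blast
  qed
qed simp

lemma has_integral_kerK_divide_square:
  assumes "0 < x" "0 < a" "a \<le> b"
  shows "((\<lambda>z. kerK x z / z\<^sup>2) has_integral
    x * sawtooth_primitive (1 / (x * a)) - x * sawtooth_primitive (1 / (x * b))) {a..b}"
proof -
  define F where "F z = - x * sawtooth_primitive (1 / (x * z))" for z
  have "((\<lambda>z. kerK x z / z\<^sup>2) has_integral F b - F a) {a..b}"
  proof (rule fundamental_theorem_of_calculus_interior_strong)
    show "finite {z. a \<le> z \<and> 1 / (x * z) \<in> \<int>}"
      using assms by (intro finite_reciprocal_Ints)
    show "(F has_vector_derivative kerK x z / z\<^sup>2) (at z)"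
      if "z \<in> {a<..<b} - {z. a \<le> z \<and> 1 / (x * z) \<in> \<int>}" for z
    proof -
      have z: "0 < z" "1 / (x * z) \<notin> \<int>"
        using that assms by auto
      have "((\<lambda>z. 1 / (x * z)) has_real_derivative - (1 / (x * z\<^sup>2))) (at z)"
        using assms z by (auto intro!: derivative_eq_intros simp: field_simps power2_eq_square)
      note DERIV_chain2[OF sawtooth_primitive_has_real_derivative[OF z(2)] this]
      from DERIV_cmult[OF this, of "- x"] have "(F has_real_derivative kerK x z / z\<^sup>2) (at z)"
        using assms z by (simp add: F_def[abs_def] kerK_def)
      then show ?thesis
        by (simp add: has_real_derivative_iff_has_vector_derivative)
    qed
    show "continuous_on {a..b} F"
    proof -
      have "continuous_on {a..b} (\<lambda>z. sawtooth_primitive (1 / (x * z)))"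
      proof (rule continuous_on_compose2[of UNIV sawtooth_primitive])
        show "continuous_on UNIV sawtooth_primitive"
          by (simp add: continuous_at_imp_continuous_on isCont_sawtooth_primitive)
        show "continuous_on {a..b} (\<lambda>z. 1 / (x * z))"
          using assms by (intro continuous_intros) auto
      qed simp
      then show ?thesis
        unfolding F_def by (intro continuous_intros)
    qed
  qed fact
  then show ?thesis
    by (simp add: F_def)
qed

lemma
  assumes x: "0 < x" and ab: "0 < a" "a \<le> b"
  shows kerK_integrable_on: "kerK x integrable_on {a..b}"
    and abs_integral_kerK_le: "\<bar>integral {a..b} (kerK x)\<bar> \<le> x * b\<^sup>2 / 4"
proof -
  define f where "f z = kerK x z / z\<^sup>2" for z
  have kerK_eq: "z\<^sup>2 * f z = kerK x z" if "z \<in> {a..b}" for z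
    using that ab by (simp add: f_def)
  have f: "f integrable_on {a..b}"
    using has_integral_kerK_divide_square[OF x ab] by (auto simp: f_def[abs_def])
  have f_bound: "\<bar>integral {c..d} f\<bar> \<le> x / 8" if "a \<le> c" "c \<le> d" "d \<le> b" for c d
  proof -
    let ?C = "sawtooth_primitive (1 / (x * c))" and ?D = "sawtooth_primitive (1 / (x * d))"
    have "integral {c..d} f = x * (?C - ?D)"
      using has_integral_kerK_divide_square[OF x, of c d] that ab
      by (auto simp: f_def[abs_def] right_diff_distrib dest: integral_unique)
    moreover have "\<bar>?C - ?D\<bar> \<le> 1 / 8"
      using sawtooth_primitive_bounds[of "1 / (x * c)"] sawtooth_primitive_bounds[of "1 / (x * d)"]
      by linarith
    ultimately show ?thesis
      using x by (simp add: abs_mult mult_left_le[of "8 * \<bar>?C - ?D\<bar>" x])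
  qed
  have mono: "mono_on {a..b} (\<lambda>z. z\<^sup>2)"
    using ab by (intro mono_onI power_mono) auto
  have weighted: "(\<lambda>z. z\<^sup>2 * f z) integrable_on {a..b}"
    and weighted_bound: "\<bar>integral {a..b} (\<lambda>z. z\<^sup>2 * f z)\<bar> \<le> x / 8 * (\<bar>a\<^sup>2\<bar> + \<bar>b\<^sup>2\<bar>)"
    using integrable_on_mono_weight[OF f ab(2) f_bound mono]
      abs_integral_mono_weight_le[OF f ab(2) f_bound mono] by blast+
  show "kerK x integrable_on {a..b}"
    using weighted kerK_eq by (rule integrable_eq)
  have "\<bar>integral {a..b} (kerK x)\<bar> = \<bar>integral {a..b} (\<lambda>z. z\<^sup>2 * f z)\<bar>"
    by (intro arg_cong[of _ _ abs] integral_cong) (simp only: kerK_eq)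
  also note weighted_bound
  also have "x / 8 * (\<bar>a\<^sup>2\<bar> + \<bar>b\<^sup>2\<bar>) \<le> x / 8 * (b\<^sup>2 + b\<^sup>2)"
    using x ab by (intro mult_left_mono add_mono) (auto simp: power_mono)
  finally show "\<bar>integral {a..b} (kerK x)\<bar> \<le> x * b\<^sup>2 / 4"
    by simp
qed

lemma abs_integral_kerK_mult_kerK_le:
  assumes x: "0 < x" and y: "0 < y" "y \<le> 1" and d: "0 < d" "d \<le> 1"
  shows "\<bar>integral {d..1} (\<lambda>z. kerK x z * kerK z y)\<bar> \<le> x / (y * d)"
proof -
  define t where "t z = 1 / (z * y)" for z
  have t_antimono: "t z' \<le> t z" if "0 < z" "z \<le> z'" for z z'
    unfolding t_def using that y by (intro divide_left_mono mult_right_mono mult_pos_pos) auto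
  have t_1: "1 \<le> t 1"
    using y by (simp add: t_def)
  have t_d: "t 1 \<le> t d"
    using d t_antimono by blast
  have mono: "mono_on {d..1} (\<lambda>z. 1/2 - t z)"
    and antimono: "antimono_on {d..1} (\<lambda>z. of_int \<lfloor>t z\<rfloor> :: real)"
    using t_antimono d by (auto simp: monotone_on_def intro!: floor_mono)
  have kerK_bound: "\<bar>integral {a..b} (kerK x)\<bar> \<le> x / 4" if "d \<le> a" "a \<le> b" "b \<le> 1" for a b
  proof -
    have "x * b\<^sup>2 / 4 \<le> x / 4"
      using x d that by (simp add: mult_left_le power_le_one)
    then show ?thesis
      using abs_integral_kerK_le[OF x, of a b] d that by linarith
  qed
  have "integral {d..1} (\<lambda>z. kerK x z * kerK z y)
      = integral {d..1} (\<lambda>z. (1/2 - t z + of_int \<lfloor>t z\<rfloor>) * kerK x z)"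
    using d y by (intro integral_cong) (simp add: kerK_eq_floor t_def)
  also have "\<bar>\<dots>\<bar> \<le> x / 4 * (\<bar>1/2 - t d\<bar> + \<bar>1/2 - t 1\<bar> + \<bar>of_int \<lfloor>t d\<rfloor>\<bar> + \<bar>of_int \<lfloor>t 1\<rfloor>\<bar>)"
    using kerK_integrable_on[OF x d] d(2) kerK_bound mono antimono
    by (rule abs_integral_mono_plus_antimono_weight_le)
  also have "\<dots> \<le> x / 4 * (4 * t d)"
  proof (rule mult_left_mono)
    have "\<bar>of_int \<lfloor>s\<rfloor>\<bar> \<le> s" "\<bar>1/2 - s\<bar> \<le> s" if "1 \<le> s" for s :: real
      using that by auto
    from this[of "t d"] this[of "t 1"] t_1 t_d
    show "\<bar>1/2 - t d\<bar> + \<bar>1/2 - t 1\<bar> + \<bar>of_int \<lfloor>t d\<rfloor>\<bar> + \<bar>of_int \<lfloor>t 1\<rfloor>\<bar> \<le> 4 * t d"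
      by linarith
  qed (use x in simp)
  finally show ?thesis
    by (simp add: t_def mult.commute)
qed

abbreviation lborel_unit :: "real measure" where
  "lborel_unit \<equiv> restrict_space lborel {0<..1}"

lemma finite_measure_lborel_unit: "finite_measure lborel_unit"
  by (rule finite_measureI) (simp add: emeasure_restrict_space space_restrict_space)

lemma borel_measurable_lborel_unitI:
  "continuous_on {0<..1} f \<Longrightarrow> f \<in> borel_measurable lborel_unit"
  using borel_measurable_continuous_on_restrict
  by (simp cong: measurable_cong_sets sets_restrict_space_cong)

lemma
  fixes f :: "real \<Rightarrow> real"
  assumes f: "f \<in> borel_measurable lborel_unit" and "f 0 = 0"
  shows set_integrable_lborel_unit_iff:
      "set_integrable lebesgue {0..1} f \<longleftrightarrow> integrable lborel_unit f"
    and set_integral_eq_lborel_unit: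
      "(LINT y:{0..1}|lebesgue. f y) = (\<integral>y. f y \<partial>lborel_unit)"
proof -
  have measurable: "(\<lambda>y. indicator {0<..1} y *\<^sub>R f y) \<in> borel_measurable lborel"
    using f by (subst (asm) borel_measurable_restrict_space_iff) auto
  have "(\<lambda>y. indicator {0..1} y *\<^sub>R f y) = (\<lambda>y. indicator {0<..1} y *\<^sub>R f y)"
    using \<open>f 0 = 0\<close> by (auto simp: indicator_def less_le)
  then show "set_integrable lebesgue {0..1} f \<longleftrightarrow> integrable lborel_unit f"
    and "(LINT y:{0..1}|lebesgue. f y) = (\<integral>y. f y \<partial>lborel_unit)"
    unfolding set_integrable_def set_lebesgue_integral_def
    by (simp_all only: integrable_completion[OF measurable] integral_completion[OF measurable])
       (simp_all add: integrable_restrict_space integral_restrict_space)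
qed

definition kerK_iterate :: "real \<Rightarrow> real \<Rightarrow> real" where
  "kerK_iterate x y = (\<integral>z. kerK x z * kerK z y \<partial>lborel_unit)"

lemma
  shows kerK_mult_kerK_integrable_on: "(\<lambda>z. kerK x z * kerK z y) integrable_on {0..1}"
    and kerK_iterate_eq_integral: "kerK_iterate x y = integral {0..1} (\<lambda>z. kerK x z * kerK z y)"
proof -
  interpret lborel_unit: finite_measure lborel_unit
    by (rule finite_measure_lborel_unit)
  have measurable: "(\<lambda>z. kerK x z * kerK z y) \<in> borel_measurable lborel_unit"
    by (simp add: measurable_restrict_space1)
  have "\<bar>kerK x z * kerK z y\<bar> \<le> 1/2" for z
    using abs_kerK_mult_le abs_kerK_le by (rule order_trans)
  then have "integrable lborel_unit (\<lambda>z. kerK x z * kerK z y)"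
    using measurable by (intro lborel_unit.integrable_const_bound[of _ "1/2"]) auto
  then have "set_integrable lebesgue {0..1} (\<lambda>z. kerK x z * kerK z y)"
    using set_integrable_lborel_unit_iff[OF measurable] by simp
  then show "(\<lambda>z. kerK x z * kerK z y) integrable_on {0..1}"
    and "kerK_iterate x y = integral {0..1} (\<lambda>z. kerK x z * kerK z y)"
    using set_integral_eq_lborel_unit[OF measurable]
    by (simp_all add: kerK_iterate_def set_lebesgue_integral_eq_integral)
qed

lemma abs_integral_kerK_mult_kerK_le_half:
  assumes "0 \<le> d" "d \<le> 1"
  shows "\<bar>integral {0..d} (\<lambda>z. kerK x z * kerK z y)\<bar> \<le> d / 2"
proof -
  let ?g = "\<lambda>z. kerK x z * kerK z y"
  have "(?g has_integral integral {0..d} ?g) {0..d}"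
    using assms integrable_subinterval_real[OF kerK_mult_kerK_integrable_on]
    by (intro integrable_integral) auto
  moreover have "norm (?g z) \<le> 1/2" for z
    using order_trans[OF abs_kerK_mult_le abs_kerK_le] by simp
  ultimately show ?thesis
    using has_integral_bound_real[of "1/2" "{}" ?g "integral {0..d} ?g" 0 d] assms by simp
qed

text \<open>The integral is split at \<open>d = sqrt (x / y)\<close>, which balances the two bounds above.\<close>

lemma abs_kerK_iterate_le:
  assumes x: "0 < x" and y: "0 < y" "y \<le> 1"
  shows "\<bar>kerK_iterate x y\<bar> \<le> 2 * sqrt (x / y)"
proof (cases "x < y")
  case True
  define d where "d = sqrt (x / y)"
  have d: "0 < d" "d \<le> 1" "x / (y * d) = d"
    using True x y by (auto simp: d_def field_simps real_sqrt_divide)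
  have "kerK_iterate x y
      = integral {0..d} (\<lambda>z. kerK x z * kerK z y) + integral {d..1} (\<lambda>z. kerK x z * kerK z y)"
    unfolding kerK_iterate_eq_integral using d
    by (intro Henstock_Kurzweil_Integration.integral_combine[symmetric]
        kerK_mult_kerK_integrable_on) auto
  moreover have "\<bar>integral {d..1} (\<lambda>z. kerK x z * kerK z y)\<bar> \<le> d"
    using abs_integral_kerK_mult_kerK_le[OF x y d(1,2)] d(3) by simp
  moreover have "\<bar>integral {0..d} (\<lambda>z. kerK x z * kerK z y)\<bar> \<le> d / 2"
    using d by (intro abs_integral_kerK_mult_kerK_le_half) auto
  ultimately show ?thesis
    using d(1) by (simp flip: d_def)
next
  case False
  then have "1 \<le> sqrt (x / y)"
    using y by simp
  then show ?thesis
    using abs_integral_kerK_mult_kerK_le_half[of 1 x y] unfolding kerK_iterate_eq_integral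
    by linarith
qed

section \<open>The integral operator\<close>

definition kerK_op :: "(real \<Rightarrow> real) \<Rightarrow> real \<Rightarrow> real" where
  "kerK_op f x = (LINT y:{0..1}|lebesgue. kerK x y * f y)"

lemma kerK_op_cong: "(\<And>y. y \<in> {0..1} \<Longrightarrow> f y = g y) \<Longrightarrow> kerK_op f x = kerK_op g x"
  unfolding kerK_op_def by (intro set_lebesgue_integral_cong) auto

lemma kerK_op_cmult: "kerK_op (\<lambda>y. c * f y) x = c * kerK_op f x"
  by (simp add: kerK_op_def mult.left_commute)

lemma set_integrable_kerK_mult:
  assumes f: "set_integrable lebesgue {0..1} f"
  shows "set_integrable lebesgue {0..1} (\<lambda>y. kerK x y * f y)"
proof (rule set_integrable_bound[OF f])
  have [measurable]: "kerK x \<in> borel_measurable lebesgue"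
    by (rule measurable_completion) measurable
  have [measurable]: "(\<lambda>y. indicator {0..1} y *\<^sub>R f y) \<in> borel_measurable lebesgue"
    using f by (simp add: set_integrable_def)
  have "(\<lambda>y. kerK x y * (indicator {0..1} y *\<^sub>R f y)) \<in> borel_measurable lebesgue"
    by measurable
  then show "set_borel_measurable lebesgue {0..1} (\<lambda>y. kerK x y * f y)"
    by (simp add: set_borel_measurable_def mult_ac)
  show "AE y in lebesgue. y \<in> {0..1} \<longrightarrow> norm (kerK x y * f y) \<le> norm (f y)"
    by (simp add: abs_kerK_mult_le)
qed

lemma abs_kerK_op_le:
  assumes f: "set_integrable lebesgue {0..1} f"
  shows "\<bar>kerK_op f x\<bar> \<le> (LINT y:{0..1}|lebesgue. \<bar>f y\<bar>)"
proof -
  have "(LINT y:{0..1}|lebesgue. \<bar>kerK x y * f y\<bar>) \<le> (LINT y:{0..1}|lebesgue. \<bar>f y\<bar>)"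
    using f
    by (intro set_integral_mono set_integrable_abs set_integrable_kerK_mult abs_kerK_mult_le)
  then show ?thesis
    using set_integral_norm_bound[OF set_integrable_kerK_mult[OF f], of x]
    by (simp add: kerK_op_def)
qed

lemma isCont_kerK:
  assumes "1 / (x * y) \<notin> \<int>"
  shows "isCont (\<lambda>x. kerK x y) x"
proof -
  have "x \<noteq> 0" "y \<noteq> 0"
    using assms by auto
  then have "isCont (\<lambda>x. 1/2 - frac (1 / (x * y))) x"
    using assms by (intro continuous_intros isCont_o2[OF _ continuous_frac]) auto
  moreover have "\<forall>\<^sub>F t in nhds x. 1/2 - frac (1 / (t * y)) = kerK t y"
    using t1_space_nhds[OF \<open>x \<noteq> 0\<close>] by eventually_elim (use \<open>y \<noteq> 0\<close> in \<open>simp add: kerK_def\<close>)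
  ultimately show ?thesis
    by (rule isCont_cong[THEN iffD1, rotated])
qed

lemma AE_isCont_kerK:
  assumes "x \<noteq> 0"
  shows "AE y in lebesgue. isCont (\<lambda>x. kerK x y) x"
proof -
  define jumps where "jumps = range (\<lambda>i::int. 1 / (x * of_int i))"
  have "jumps \<in> null_sets lborel"
    unfolding jumps_def by (intro countable_imp_null_set_lborel) auto
  then have "AE y in lebesgue. y \<notin> jumps"
    by (intro AE_completion AE_not_in)
  moreover have "isCont (\<lambda>x. kerK x y) x" if "y \<notin> jumps" for y
  proof (rule isCont_kerK, rule notI)
    assume "1 / (x * y) \<in> \<int>"
    then obtain i :: int where "y = 1 / (x * of_int i)"
      using assms by (rule reciprocal_IntsE)
    then show False
      using that unfolding jumps_def by blast
  qed
  ultimately show ?thesis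
    by (auto elim: eventually_mono)
qed

lemma isCont_kerK_op:
  assumes f: "set_integrable lebesgue {0..1} f" and "x \<noteq> 0"
  shows "isCont (kerK_op f) x"
proof (rule continuous_at_sequentiallyI)
  fix u assume u: "u \<longlonglongrightarrow> x"
  show "(\<lambda>n. kerK_op f (u n)) \<longlonglongrightarrow> kerK_op f x"
    unfolding kerK_op_def set_lebesgue_integral_def
  proof (rule integral_dominated_convergence)
    show "integrable lebesgue (\<lambda>y. indicator {0..1} y *\<^sub>R \<bar>f y\<bar>)"
      using set_integrable_abs[OF f] by (simp add: set_integrable_def)
    show "AE y in lebesgue. (\<lambda>n. indicator {0..1} y *\<^sub>R (kerK (u n) y * f y))
        \<longlonglongrightarrow> indicator {0..1} y *\<^sub>R (kerK x y * f y)"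
      using AE_isCont_kerK[OF \<open>x \<noteq> 0\<close>]
      by eventually_elim (intro tendsto_intros isCont_tendsto_compose[OF _ u])
    show "AE y in lebesgue. norm (indicator {0..1} y *\<^sub>R (kerK (u n) y * f y))
        \<le> indicator {0..1} y *\<^sub>R \<bar>f y\<bar>" for n
      by (simp add: indicator_def abs_kerK_mult_le)
  qed (use set_integrable_kerK_mult[OF f] in \<open>auto simp: set_integrable_def\<close>)
qed

lemma
  shows integrable_inverse_sqrt: "integrable lborel_unit (\<lambda>y. 1 / sqrt y)"
    and integral_inverse_sqrt: "(\<integral>y. 1 / sqrt y \<partial>lborel_unit) = 2"
proof -
  have "((\<lambda>y. y powr (-1/2)) has_integral 2) {0..1::real}"
    using has_integral_powr_from_0[of "-1/2" 1] by simp
  moreover have "y powr (-1/2) = 1 / sqrt y" if "y \<in> {0..1}" for y :: real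
    using that powr_minus_divide[of y "1/2"] by (simp add: powr_half_sqrt)
  ultimately have integral: "((\<lambda>y. 1 / sqrt y) has_integral 2) {0..1::real}"
    by (rule has_integral_eq[rotated])
  then have integrable: "set_integrable lebesgue {0..1} (\<lambda>y::real. 1 / sqrt y)"
    by (intro nonnegative_absolutely_integrable_1) auto
  have measurable: "(\<lambda>y. 1 / sqrt y) \<in> borel_measurable lborel_unit"
    by (intro borel_measurable_lborel_unitI continuous_intros) auto
  show "integrable lborel_unit (\<lambda>y. 1 / sqrt y)"
    using set_integrable_lborel_unit_iff[OF measurable] integrable by simp
  show "(\<integral>y. 1 / sqrt y \<partial>lborel_unit) = 2"
    using set_integral_eq_lborel_unit[OF measurable] integral_unique[OF integral]
      set_lebesgue_integral_eq_integral(2)[OF integrable] by simp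
qed

lemma kerK_op_eq_lborel_unit:
  assumes f: "f \<in> borel_measurable lborel_unit"
  shows "kerK_op f x = (\<integral>y. kerK x y * f y \<partial>lborel_unit)"
  unfolding kerK_op_def
proof (rule set_integral_eq_lborel_unit)
  have "kerK x \<in> borel_measurable lborel_unit"
    by (simp add: measurable_restrict_space1)
  then show "(\<lambda>y. kerK x y * f y) \<in> borel_measurable lborel_unit"
    using f by (rule borel_measurable_times)
qed simp

lemma kerK_op_kerK_op:
  assumes f [measurable]: "f \<in> borel_measurable lborel_unit"
    and f_le: "\<And>y. y \<in> {0<..1} \<Longrightarrow> \<bar>f y\<bar> \<le> M"
  shows "kerK_op (kerK_op f) x = (\<integral>y. kerK_iterate x y * f y \<partial>lborel_unit)"
proof -
  interpret lborel_unit: finite_measure lborel_unit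
    by (rule finite_measure_lborel_unit)
  interpret pair: pair_sigma_finite lborel_unit lborel_unit ..
  interpret pair: finite_measure "lborel_unit \<Otimes>\<^sub>M lborel_unit"
    by (intro finite_measure_pair_measure finite_measure_lborel_unit)
  have [measurable]: "(\<lambda>y. y) \<in> borel_measurable lborel_unit"
    by (intro borel_measurable_lborel_unitI continuous_on_id)
  have measurable [measurable]: "kerK_op f \<in> borel_measurable lborel_unit"
    unfolding kerK_op_eq_lborel_unit[OF f, abs_def] by measurable
  have "integrable (lborel_unit \<Otimes>\<^sub>M lborel_unit) (\<lambda>(z, y). kerK x z * (kerK z y * f y))"
  proof (rule pair.integrable_const_bound)
    have "\<bar>kerK x z * (kerK z y * f y)\<bar> \<le> M" if "y \<in> {0<..1}" for z y
      using abs_kerK_mult_le[of x z "kerK z y * f y"] abs_kerK_mult_le[of z y "f y"] f_le[OF that]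
      by linarith
    then show "AE p in lborel_unit \<Otimes>\<^sub>M lborel_unit.
        norm (case p of (z, y) \<Rightarrow> kerK x z * (kerK z y * f y)) \<le> M"
      by (intro AE_I2) (auto simp: space_pair_measure space_restrict_space)
  qed measurable
  note Fubini = pair.Fubini_integral[OF this]
  have "kerK_op (kerK_op f) x = (\<integral>z. kerK x z * kerK_op f z \<partial>lborel_unit)"
    by (rule kerK_op_eq_lborel_unit[OF measurable])
  also have "\<dots> = (\<integral>z. (\<integral>y. kerK x z * (kerK z y * f y) \<partial>lborel_unit) \<partial>lborel_unit)"
    by (simp add: kerK_op_eq_lborel_unit[OF f])
  also have "\<dots> = (\<integral>y. (\<integral>z. kerK x z * (kerK z y * f y) \<partial>lborel_unit) \<partial>lborel_unit)"
    by (rule Fubini[symmetric])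
  also have "\<dots> = (\<integral>y. kerK_iterate x y * f y \<partial>lborel_unit)"
    by (simp add: kerK_iterate_def flip: mult.assoc)
  finally show ?thesis .
qed

lemma abs_kerK_op_kerK_op_le:
  assumes f: "f \<in> borel_measurable lborel_unit"
    and f_le: "\<And>y. y \<in> {0<..1} \<Longrightarrow> \<bar>f y\<bar> \<le> M" and x: "0 < x"
  shows "\<bar>kerK_op (kerK_op f) x\<bar> \<le> 4 * M * sqrt x"
proof -
  have M_nonneg: "0 \<le> M"
    using f_le[of 1] by simp
  have kernel_le: "\<bar>kerK_iterate x y * f y\<bar> \<le> 2 * M * sqrt x * (1 / sqrt y)"
    if "y \<in> space lborel_unit" for y
  proof -
    have y: "y \<in> {0<..1}"
      using that by (simp add: space_restrict_space)
    then have "\<bar>kerK_iterate x y * f y\<bar> \<le> 2 * sqrt (x / y) * M"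
      unfolding abs_mult using x by (intro mult_mono abs_kerK_iterate_le f_le) auto
    then show ?thesis
      by (simp add: real_sqrt_divide mult_ac)
  qed
  have "\<bar>kerK_op (kerK_op f) x\<bar> \<le> (\<integral>y. \<bar>kerK_iterate x y * f y\<bar> \<partial>lborel_unit)"
    using kerK_op_kerK_op[OF f f_le] by (simp add: integral_abs_bound)
  also have "\<dots> \<le> (\<integral>y. 2 * M * sqrt x * (1 / sqrt y) \<partial>lborel_unit)"
    using M_nonneg x
    by (intro integral_mono' integrable_mult_right integrable_inverse_sqrt kernel_le) auto
  also have "\<dots> = 2 * M * sqrt x * 2"
    by (simp only: integral_mult_right_zero integral_inverse_sqrt)
  finally show ?thesis
    by simp
qed

section \<open>Termwise differentiation\<close>

lemma sum_of_bool_eq_min_floor: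
  "(\<Sum>m<N. of_bool (0 < m \<and> real m \<le> t)) = real (min (N - 1) (nat \<lfloor>t\<rfloor>))"
proof -
  have "{m \<in> {..<N}. 0 < m \<and> real m \<le> t} = {1..min (N - 1) (nat \<lfloor>t\<rfloor>)}"
    by (auto simp: le_nat_floor) linarith+
  moreover have "(\<Sum>m<N. of_bool (0 < m \<and> real m \<le> t))
      = real (card {m \<in> {..<N}. 0 < m \<and> real m \<le> t})"
    by (simp add: of_bool_def flip: sum.inter_filter)
  ultimately show ?thesis
    by simp
qed

lemma min_nat_floor_le: "0 \<le> t \<Longrightarrow> real (min N (nat \<lfloor>t\<rfloor>)) \<le> t"
  by linarith

lemma min_nat_floor_tendsto:
  assumes "0 \<le> t"
  shows "(\<lambda>N. real (min (N - 1) (nat \<lfloor>t\<rfloor>))) \<longlonglongrightarrow> of_int \<lfloor>t\<rfloor>"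
proof (rule tendsto_eventually, rule eventually_mono)
  show "\<forall>\<^sub>F N in sequentially. nat \<lfloor>t\<rfloor> < N"
    by (rule eventually_gt_at_top)
  show "real (min (N - 1) (nat \<lfloor>t\<rfloor>)) = of_int \<lfloor>t\<rfloor>" if "nat \<lfloor>t\<rfloor> < N" for N
  proof -
    have "min (N - 1) (nat \<lfloor>t\<rfloor>) = nat \<lfloor>t\<rfloor>"
      using that by linarith
    then show ?thesis
      using assms by simp
  qed
qed

text \<open>\<open>reciprocal_gap 0 = {1<..<0}\<close> is empty because \<open>1 / 0 = 0\<close>.\<close>

definition reciprocal_gap :: "nat \<Rightarrow> real set" where
  "reciprocal_gap n = {1 / real (n + 1)<..<1 / real n}"

lemma reciprocal_gapD:
  assumes "x \<in> reciprocal_gap n"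
  shows "0 < x" "x < 1" "real n < 1 / x" "1 / x < real (n + 1)"
proof -
  have x: "1 / real (n + 1) < x" "x < 1 / real n"
    using assms by (auto simp: reciprocal_gap_def)
  have "0 < 1 / real (n + 1)"
    by simp
  with x(1) show pos: "0 < x"
    by linarith
  have "1 / real n \<le> 1"
    by (cases "n = 0") auto
  with x(2) show "x < 1"
    by linarith
  show "1 / x < real (n + 1)"
    using x(1) pos by (simp add: field_simps)
  show "real n < 1 / x"
    using x(2) pos by (cases "n = 0") (auto simp: field_simps)
qed

lemma ex_reciprocal_gap:
  assumes "0 < x" "x < 1" "1 / x \<notin> \<int>"
  obtains n where "x \<in> reciprocal_gap n"
proof -
  define n where "n = nat \<lfloor>1 / x\<rfloor>"
  have n: "1 \<le> n" "real n = of_int \<lfloor>1 / x\<rfloor>"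
    using assms by (auto simp: n_def le_nat_iff)
  then have "real n \<noteq> 1 / x"
    using assms(3) by (metis Ints_of_int)
  then have "real n < 1 / x" "1 / x < real (n + 1)"
    using n by linarith+
  then show ?thesis
    using that[of n] assms n by (simp add: reciprocal_gap_def field_simps)
qed

lemma reciprocal_gap_one_le:
  assumes "x \<in> reciprocal_gap n" "0 < m" "m \<le> n"
  shows "1 \<le> 1 / (real m * x)"
proof -
  have "real m \<le> 1 / x"
    using reciprocal_gapD(3)[OF assms(1)] assms(3) by linarith
  then show ?thesis
    using reciprocal_gapD(1)[OF assms(1)] assms(2) by (simp add: field_simps)
qed

lemma reciprocal_gap_less_one:
  assumes "x \<in> reciprocal_gap n" "n + 1 \<le> m"
  shows "1 / (real m * x) < 1"
proof -
  have "1 / x < real m"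
    using reciprocal_gapD(4)[OF assms(1)] assms(2) by linarith
  then show ?thesis
    using reciprocal_gapD(1)[OF assms(1)] by (simp add: field_simps)
qed

locale sqrt_decaying =
  fixes f :: "real \<Rightarrow> real" and C :: real
  assumes continuous_on_f: "continuous_on {0..1} f"
    and abs_f_le: "\<And>x. x \<in> {0..1} \<Longrightarrow> \<bar>f x\<bar> \<le> C * sqrt x"
begin

lemma f_0: "f 0 = 0"
  using abs_f_le[of 0] by simp

lemma C_nonneg: "0 \<le> C"
  using abs_f_le[of 1] by simp

lemma set_integrable_f: "set_integrable lebesgue {0..1} f"
  using continuous_on_f by (intro absolutely_integrable_continuous_real)

lemma set_integrable_f_divide: "set_integrable lebesgue {0..1} (\<lambda>y. f y / y)"
proof -
  have "continuous_on {0<..1} (\<lambda>y. f y / y)"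
    by (intro continuous_intros continuous_on_subset[OF continuous_on_f]) auto
  then have f: "(\<lambda>y. f y / y) \<in> borel_measurable lborel_unit"
    by (rule borel_measurable_lborel_unitI)
  have dominating: "integrable lborel_unit (\<lambda>y. C * (1 / sqrt y))"
    by (intro integrable_mult_right integrable_inverse_sqrt)
  have "norm (f y / y) \<le> norm (C * (1 / sqrt y))" if "y \<in> space lborel_unit" for y
  proof -
    have y: "y \<in> {0<..1}"
      using that by (simp add: space_restrict_space)
    then have "norm (f y / y) \<le> C * sqrt y / y"
      using abs_f_le[of y] by (simp add: divide_right_mono)
    also have "\<dots> = norm (C * (1 / sqrt y))"
      using y C_nonneg real_div_sqrt[of y] by (simp add: field_simps)
    finally show ?thesis .
  qed
  then have "integrable lborel_unit (\<lambda>y. f y / y)"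
    by (intro Bochner_Integration.integrable_bound[OF dominating f] AE_I2)
  then show ?thesis
    using set_integrable_lborel_unit_iff[OF f] by simp
qed

definition reciprocal_moment :: real where
  "reciprocal_moment = (LINT y:{0..1}|lebesgue. f y / y)"

definition primitive :: "real \<Rightarrow> real" where
  "primitive t = integral {0..t} f"

lemma primitive_has_real_derivative:
  assumes "0 < t" "t < 1"
  shows "(primitive has_real_derivative f t) (at t)"
  using integral_has_real_derivative[OF continuous_on_f, of t] assms
  by (simp add: primitive_def[abs_def] at_within_Icc_at)

lemma f_has_integral_primitive: "0 \<le> c \<Longrightarrow> c \<le> 1 \<Longrightarrow> (f has_integral primitive c) {0..c}"
  unfolding primitive_def
  by (intro integrable_integral integrable_continuous_real
      continuous_on_subset[OF continuous_on_f]) auto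

lemma sum_truncations_eq:
  assumes "0 < x" "y \<in> {0..1}"
  shows "(\<Sum>m<N. if y \<in> {0..min 1 (1 / (real m * x))} then f y else 0)
    = real (min (N - 1) (nat \<lfloor>1 / (x * y)\<rfloor>)) * f y"
proof (cases "y = 0")
  case False
  have "(\<Sum>m<N. if y \<in> {0..min 1 (1 / (real m * x))} then f y else 0)
      = (\<Sum>m<N. of_bool (0 < m \<and> real m \<le> 1 / (x * y)) * f y)"
  proof (rule sum.cong)
    fix m
    have "y \<in> {0..min 1 (1 / (real m * x))} \<longleftrightarrow> 0 < m \<and> real m \<le> 1 / (x * y)"
      using assms False by (cases "m = 0") (auto simp: field_simps)
    then show "(if y \<in> {0..min 1 (1 / (real m * x))} then f y else 0)
        = of_bool (0 < m \<and> real m \<le> 1 / (x * y)) * f y"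
      by simp
  qed simp
  then show ?thesis
    by (simp only: sum_of_bool_eq_min_floor flip: sum_distrib_right)
qed (simp add: f_0 sum.neutral)

lemma capped_floor_has_integral:
  assumes x: "0 < x"
  shows "((\<lambda>y. real (min (N - 1) (nat \<lfloor>1 / (x * y)\<rfloor>)) * f y) has_integral
    (\<Sum>m<N. primitive (min 1 (1 / (real m * x))))) {0..1}"
proof (rule has_integral_eq)
  have "((\<lambda>y. if y \<in> {0..min 1 (1 / (real m * x))} then f y else 0)
      has_integral primitive (min 1 (1 / (real m * x)))) {0..1}" for m
    using x by (subst has_integral_restrict) (auto intro!: f_has_integral_primitive)
  then show "((\<lambda>y. \<Sum>m<N. if y \<in> {0..min 1 (1 / (real m * x))} then f y else 0)
      has_integral (\<Sum>m<N. primitive (min 1 (1 / (real m * x))))) {0..1}"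
    by (intro has_integral_sum) auto
qed (rule sum_truncations_eq[OF x])

text \<open>The term for \<open>m = 0\<close> is \<open>primitive 0 = 0\<close> because \<open>1 / 0 = 0\<close>.\<close>

lemma
  assumes x: "0 < x"
  shows floor_mult_integrable_on: "(\<lambda>y. of_int \<lfloor>1 / (x * y)\<rfloor> * f y) integrable_on {0..1}"
    and primitive_min_sums: "(\<lambda>m. primitive (min 1 (1 / (real m * x)))) sums
      integral {0..1} (\<lambda>y. of_int \<lfloor>1 / (x * y)\<rfloor> * f y)"
proof -
  define F where "F N y = real (min (N - 1) (nat \<lfloor>1 / (x * y)\<rfloor>)) * f y" for N y
  have F_integral: "(F N has_integral (\<Sum>m<N. primitive (min 1 (1 / (real m * x))))) {0..1}" for N
    unfolding F_def by (rule capped_floor_has_integral[OF x])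
  then have F_integrable: "F N integrable_on {0..1}" for N
    by blast
  have dominating: "(\<lambda>y. \<bar>f y / y\<bar> / x) integrable_on {0..1}"
    using set_integrable_abs[OF set_integrable_f_divide]
    by (intro integrable_on_divide set_lebesgue_integral_eq_integral(1))
  have F_le: "norm (F N y) \<le> \<bar>f y / y\<bar> / x" if y: "y \<in> {0..1}" for N y
  proof -
    have "norm (F N y) \<le> 1 / (x * y) * \<bar>f y\<bar>"
      unfolding F_def norm_mult using x y by (intro mult_mono) (auto intro: min_nat_floor_le)
    then show ?thesis
      using x y by (simp add: mult.commute)
  qed
  have F_lim: "(\<lambda>N. F N y) \<longlonglongrightarrow> of_int \<lfloor>1 / (x * y)\<rfloor> * f y" if "y \<in> {0..1}" for y
    unfolding F_def using x that by (intro tendsto_mult_right min_nat_floor_tendsto) simp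
  note limit = dominated_convergence[OF F_integrable dominating F_le F_lim]
  show "(\<lambda>y. of_int \<lfloor>1 / (x * y)\<rfloor> * f y) integrable_on {0..1}"
    by (rule limit(1))
  show "(\<lambda>m. primitive (min 1 (1 / (real m * x)))) sums
      integral {0..1} (\<lambda>y. of_int \<lfloor>1 / (x * y)\<rfloor> * f y)"
    using limit(2) unfolding sums_def by (simp only: integral_unique[OF F_integral])
qed

lemma kerK_op_eq_series:
  assumes x: "0 < x"
  shows "kerK_op f x
    = primitive 1 / 2 - reciprocal_moment / x + (\<Sum>m. primitive (min 1 (1 / (real m * x))))"
proof -
  let ?floor = "\<lambda>y. of_int \<lfloor>1 / (x * y)\<rfloor> * f y"
  have "((\<lambda>y. f y / y) has_integral reciprocal_moment) {0..1}"
    unfolding reciprocal_moment_def by (intro has_integral_set_lebesgue set_integrable_f_divide)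
  then have "((\<lambda>y. 1/2 * f y - 1/x * (f y / y) + ?floor y) has_integral
      1/2 * primitive 1 - 1/x * reciprocal_moment + integral {0..1} ?floor) {0..1}"
    using x by (intro has_integral_add has_integral_diff has_integral_mult_right integrable_integral
        f_has_integral_primitive floor_mult_integrable_on) auto
  moreover have "1/2 * f y - 1/x * (f y / y) + ?floor y = kerK x y * f y" for y
    using x f_0 by (cases "y = 0") (simp_all add: kerK_eq_floor algebra_simps)
  ultimately have "integral {0..1} (\<lambda>y. kerK x y * f y)
      = 1/2 * primitive 1 - 1/x * reciprocal_moment + integral {0..1} ?floor"
    by (simp add: integral_unique)
  then show ?thesis
    using sums_unique[OF primitive_min_sums[OF x]]
      set_lebesgue_integral_eq_integral(2)[OF set_integrable_kerK_mult[OF set_integrable_f]]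
    by (simp add: kerK_op_def)
qed

definition tail_term :: "nat \<Rightarrow> nat \<Rightarrow> real \<Rightarrow> real" where
  "tail_term n m x = (if m \<ge> n + 1 then f (1 / (real m * x)) / real m else 0)"

definition tail_bound :: "nat \<Rightarrow> nat \<Rightarrow> real" where
  "tail_bound n m = C * sqrt (real (n + 1)) * real m powr (-3/2)"

lemma summable_tail_bound: "summable (tail_bound n)"
  unfolding tail_bound_def[abs_def] by (intro summable_mult) (simp add: summable_real_powr_iff)

lemma tail_argument_bounds:
  assumes "n + 1 \<le> m" "1 / real (n + 1) \<le> x"
  shows "0 < 1 / (real m * x)" "1 / (real m * x) \<le> real (n + 1) / real m"
    and "1 / (real m * x) \<in> {0..1}"
proof -
  have x: "0 < x"
    using assms(2) by (rule less_le_trans[rotated]) simp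
  then show pos: "0 < 1 / (real m * x)"
    using assms by simp
  show "1 / (real m * x) \<le> real (n + 1) / real m"
    using assms x by (simp add: field_simps)
  also have "\<dots> \<le> 1"
    using assms by simp
  finally show "1 / (real m * x) \<in> {0..1}"
    using pos by simp
qed

lemma norm_tail_term_le:
  assumes x: "1 / real (n + 1) \<le> x"
  shows "norm (tail_term n m x) \<le> tail_bound n m"
proof (cases "n + 1 \<le> m")
  case True
  note argument = tail_argument_bounds[OF True x]
  have m_pos: "0 < real m"
    using True by simp
  have "\<bar>f (1 / (real m * x))\<bar> \<le> C * sqrt (1 / (real m * x))"
    by (intro abs_f_le argument)
  also have "\<dots> \<le> C * sqrt (real (n + 1) / real m)"
    using C_nonneg by (intro mult_left_mono real_sqrt_le_mono argument)
  finally have "norm (tail_term n m x) \<le> C * sqrt (real (n + 1) / real m) / real m"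
    using True by (simp add: tail_term_def divide_right_mono)
  also have "\<dots> = C * sqrt (real (n + 1)) * (1 / (sqrt (real m) * real m))"
    by (simp add: real_sqrt_divide)
  also have "sqrt (real m) * real m = real m powr (3/2)"
    using m_pos powr_add[of "real m" "1/2" 1] by (simp add: powr_half_sqrt)
  also have "1 / real m powr (3/2) = real m powr (-3/2)"
    using powr_minus_divide[of "real m" "3/2"] by simp
  finally show ?thesis
    by (simp add: tail_bound_def)
qed (simp add: tail_term_def tail_bound_def C_nonneg)

lemma summable_tail_term: "1 / real (n + 1) \<le> x \<Longrightarrow> summable (\<lambda>m. tail_term n m x)"
  using norm_tail_term_le by (intro summable_comparison_test'[OF summable_tail_bound])

lemma continuous_on_tail_sum: "continuous_on {1 / real (n + 1)..} (\<lambda>x. \<Sum>m. tail_term n m x)"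
proof -
  let ?S = "{1 / real (n + 1)..}"
  have "continuous_on ?S (tail_term n m)" for m
  proof (cases "n + 1 \<le> m")
    case True
    have "continuous_on ?S (\<lambda>x. f (1 / (real m * x)))"
    proof (rule continuous_on_compose2[OF continuous_on_f])
      show "continuous_on ?S (\<lambda>x. 1 / (real m * x))"
        using tail_argument_bounds(1)[OF True] by (intro continuous_intros) fastforce
      show "(\<lambda>x. 1 / (real m * x)) ` ?S \<subseteq> {0..1}"
        using tail_argument_bounds(3)[OF True] by blast
    qed
    then have "continuous_on ?S (\<lambda>x. f (1 / (real m * x)) / real m)"
      using True by (intro continuous_on_divide continuous_on_const) auto
    then show ?thesis
      using True by (simp add: tail_term_def[abs_def])
  qed (simp add: tail_term_def[abs_def])
  then have "\<forall>\<^sub>F N in sequentially. continuous_on ?S (\<lambda>x. \<Sum>m<N. tail_term n m x)"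
    by (intro always_eventually allI continuous_on_sum)
  moreover have "uniform_limit ?S (\<lambda>N x. \<Sum>m<N. tail_term n m x)
      (\<lambda>x. \<Sum>m. tail_term n m x) sequentially"
    using norm_tail_term_le by (intro Weierstrass_m_test[OF _ summable_tail_bound]) auto
  ultimately show ?thesis
    by (rule uniform_limit_theorem) simp
qed

lemma tail_term_reciprocal:
  "tail_term n m (1 / real k) = (if m \<ge> n + 1 then f (real k / real m) / real m else 0)"
  by (auto simp: tail_term_def)

definition kerK_op_deriv :: "nat \<Rightarrow> real \<Rightarrow> real" where
  "kerK_op_deriv n x = (reciprocal_moment - (\<Sum>m. tail_term n m x)) / x\<^sup>2"

lemma continuous_on_kerK_op_deriv: "continuous_on {1 / real (n + 1)..} (kerK_op_deriv n)"
proof -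
  have "x \<noteq> 0" if "1 / real (n + 1) \<le> x" for x
    using that by (auto simp: not_le)
  then show ?thesis
    unfolding kerK_op_deriv_def by (intro continuous_intros continuous_on_tail_sum) auto
qed

lemma primitive_min_has_real_derivative:
  assumes x: "x \<in> reciprocal_gap n"
  shows "((\<lambda>x. primitive (min 1 (1 / (real m * x))))
    has_real_derivative - (tail_term n m x / x\<^sup>2)) (at x)"
proof -
  have gap_open: "open (reciprocal_gap n)"
    by (simp add: reciprocal_gap_def)
  consider (tail) "n + 1 \<le> m" | (head) "0 < m" "m \<le> n" | (zero) "m = 0"
    by linarith
  then show ?thesis
  proof cases
    case tail
    note less = reciprocal_gap_less_one[OF _ tail]
    have pos: "0 < x"
      by (rule reciprocal_gapD(1)[OF x])
    then have "((\<lambda>x. 1 / (real m * x)) has_real_derivative - (1 / (real m * x\<^sup>2))) (at x)"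
      using tail by (auto intro!: derivative_eq_intros simp: field_simps power2_eq_square)
    from DERIV_chain2[OF primitive_has_real_derivative this]
    have "((\<lambda>x. primitive (1 / (real m * x))) has_real_derivative - (tail_term n m x / x\<^sup>2)) (at x)"
      using tail pos less[OF x] by (simp add: tail_term_def)
    then show ?thesis
      by (rule has_field_derivative_transform_within_open[OF _ gap_open x])
         (simp only: min_absorb2[OF less_imp_le[OF less]])
  next
    case head
    then have "((\<lambda>x. primitive 1) has_real_derivative - (tail_term n m x / x\<^sup>2)) (at x)"
      by (simp add: tail_term_def)
    then show ?thesis
      by (rule has_field_derivative_transform_within_open[OF _ gap_open x])
         (simp only: min_absorb1[OF reciprocal_gap_one_le[OF _ head]])
  qed (simp add: tail_term_def)
qed

lemma uniformly_convergent_on_derivative_sums: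
  "uniformly_convergent_on (reciprocal_gap n) (\<lambda>N t. \<Sum>m<N. - (tail_term n m t / t\<^sup>2))"
proof (rule Weierstrass_m_test'[OF _ summable_mult[OF summable_tail_bound]])
  fix m t assume t: "t \<in> reciprocal_gap n"
  have "(1 / t)\<^sup>2 \<le> (real (n + 1))\<^sup>2"
    using reciprocal_gapD[OF t] by (intro power_mono) auto
  then have "(1 / t)\<^sup>2 * norm (tail_term n m t) \<le> (real (n + 1))\<^sup>2 * tail_bound n m"
    using t by (intro mult_mono norm_tail_term_le) (auto simp: reciprocal_gap_def)
  then show "norm (- (tail_term n m t / t\<^sup>2)) \<le> (real (n + 1))\<^sup>2 * tail_bound n m"
    by (simp add: power_divide)
qed

lemma kerK_op_has_real_derivative:
  assumes x: "x \<in> reciprocal_gap n"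
  shows "(kerK_op f has_real_derivative kerK_op_deriv n x) (at x)"
proof -
  let ?u = "\<lambda>m x. primitive (min 1 (1 / (real m * x)))"
  have gap: "open (reciprocal_gap n)" "convex (reciprocal_gap n)"
    by (simp_all add: reciprocal_gap_def)
  have pos: "0 < t" if "t \<in> reciprocal_gap n" for t
    using reciprocal_gapD(1)[OF that] .
  have "((\<lambda>x. \<Sum>m. ?u m x) has_real_derivative (\<Sum>m. - (tail_term n m x / x\<^sup>2))) (at x)"
  proof (rule has_field_derivative_series'(2)[OF gap(2)])
    show "(?u m has_real_derivative - (tail_term n m t / t\<^sup>2)) (at t within reciprocal_gap n)"
      if "t \<in> reciprocal_gap n" for m t
      using primitive_min_has_real_derivative[OF that] by (rule has_field_derivative_at_within)
    show "summable (\<lambda>m. ?u m x)"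
      using primitive_min_sums[OF pos[OF x]] by (rule sums_summable)
    show "x \<in> interior (reciprocal_gap n)"
      using x gap(1) by (simp add: interior_open)
  qed (fact x uniformly_convergent_on_derivative_sums)+
  also have "(\<Sum>m. - (tail_term n m x / x\<^sup>2)) = - ((\<Sum>m. tail_term n m x) / x\<^sup>2)"
    using summable_tail_term[of n x] x
    by (simp add: suminf_minus suminf_divide summable_divide reciprocal_gap_def)
  finally have "((\<lambda>x. primitive 1 / 2 - reciprocal_moment / x + (\<Sum>m. ?u m x))
      has_real_derivative kerK_op_deriv n x) (at x)"
    using pos[OF x] by (auto intro!: derivative_eq_intros
        simp: kerK_op_deriv_def power2_eq_square diff_divide_distrib)
  then show ?thesis
    by (rule has_field_derivative_transform_within_open[OF _ gap(1) x])
       (simp add: kerK_op_eq_series pos)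
qed

end

section \<open>Eigenfunctions\<close>

lemma L2_imp_set_integrable:
  assumes "L2 f"
  shows "set_integrable lebesgue {0..1} f"
proof -
  interpret finite_measure "lebesgue_on {0..1::real}"
    by (rule finite_measure_lebesgue_on) simp
  have "f \<in> borel_measurable (lebesgue_on {0..1})" "integrable (lebesgue_on {0..1}) (\<lambda>x. (f x)\<^sup>2)"
    using assms by (simp_all add: L2_def set_borel_measurable_def set_integrable_def
        borel_measurable_restrict_space_iff integrable_restrict_space)
  then have "integrable (lebesgue_on {0..1}) f"
    by (rule square_integrable_imp_integrable)
  then show ?thesis
    by (simp add: set_integrable_def integrable_restrict_space)
qed

locale kerK_eigenfunction =
  fixes phi :: "real \<Rightarrow> real" and lam :: real
  assumes eigenfun: "eigenfun phi lam"
begin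

lemma phi_eq: "x \<in> {0..1} \<Longrightarrow> phi x = lam * kerK_op phi x"
  using eigenfun by (simp add: eigenfun_def kerK_op_def)

lemma lam_nonzero: "lam \<noteq> 0"
proof
  assume "lam = 0"
  then have "inner01 phi phi = (LINT x:{0..1::real}|lebesgue. 0)"
    unfolding inner01_def by (intro set_lebesgue_integral_cong) (auto simp: phi_eq)
  then show False
    using eigenfun by (simp add: eigenfun_def norm01_def set_lebesgue_integral_def)
qed

lemma set_integrable_phi: "set_integrable lebesgue {0..1} phi"
  using eigenfun by (auto simp: eigenfun_def intro: L2_imp_set_integrable)

lemma abs_phi_le: "x \<in> {0..1} \<Longrightarrow> \<bar>phi x\<bar> \<le> \<bar>lam\<bar> * (LINT y:{0..1}|lebesgue. \<bar>phi y\<bar>)"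
  unfolding phi_eq abs_mult by (intro mult_left_mono abs_kerK_op_le set_integrable_phi) simp

lemma continuous_on_phi_pos: "continuous_on {0<..1} phi"
proof (rule continuous_on_eq)
  show "continuous_on {0<..1} (\<lambda>x. lam * kerK_op phi x)"
    by (intro continuous_at_imp_continuous_on ballI continuous_intros isCont_kerK_op
        set_integrable_phi) auto
qed (simp add: phi_eq)

definition decay_constant :: real where
  "decay_constant = 4 * \<bar>lam\<bar> ^ 3 * (LINT y:{0..1}|lebesgue. \<bar>phi y\<bar>)"

lemma abs_phi_le_sqrt:
  assumes "x \<in> {0..1}"
  shows "\<bar>phi x\<bar> \<le> decay_constant * sqrt x"
proof (cases "x = 0")
  case True
  then show ?thesis
    using phi_eq[of 0] by (simp add: kerK_op_def kerK_def)
next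
  case False
  have "phi x = lam * kerK_op phi x"
    by (rule phi_eq[OF assms])
  also have "kerK_op phi x = kerK_op (\<lambda>y. lam * kerK_op phi y) x"
    by (intro kerK_op_cong phi_eq)
  finally have phi_eq_twice: "phi x = lam\<^sup>2 * kerK_op (kerK_op phi) x"
    by (simp only: kerK_op_cmult power2_eq_square mult.assoc)
  have "\<bar>kerK_op (kerK_op phi) x\<bar> \<le> 4 * (\<bar>lam\<bar> * (LINT y:{0..1}|lebesgue. \<bar>phi y\<bar>)) * sqrt x"
    using assms False
    by (intro abs_kerK_op_kerK_op_le borel_measurable_lborel_unitI continuous_on_phi_pos
        abs_phi_le) auto
  then have "lam\<^sup>2 * \<bar>kerK_op (kerK_op phi) x\<bar>
      \<le> lam\<^sup>2 * (4 * (\<bar>lam\<bar> * (LINT y:{0..1}|lebesgue. \<bar>phi y\<bar>)) * sqrt x)"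
    by (rule mult_left_mono) simp
  then show ?thesis
    by (simp add: decay_constant_def phi_eq_twice abs_mult power3_eq_cube power2_eq_square mult_ac)
qed

lemma continuous_on_phi: "continuous_on {0..1} phi"
  unfolding continuous_on_def
proof
  fix x :: real assume x: "x \<in> {0..1}"
  show "(phi \<longlongrightarrow> phi x) (at x within {0..1})"
  proof (cases "x = 0")
    case True
    have "(phi \<longlongrightarrow> 0) (at 0 within {0..1})"
    proof (rule Lim_null_comparison)
      show "\<forall>\<^sub>F x in at 0 within {0..1}. norm (phi x) \<le> decay_constant * sqrt x"
        using abs_phi_le_sqrt by (auto simp: eventually_at_filter)
    qed (auto intro!: tendsto_eq_intros)
    then show ?thesis
      using True abs_phi_le_sqrt[of 0] by simp
  next
    case False
    then have "at x within {0..1} = at x within {0<..1}"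
      using x by (intro at_within_nhd[of _ "{0<..}"]) auto
    then show ?thesis
      using continuous_on_phi_pos x False by (auto simp: continuous_on_def)
  qed
qed

sublocale sqrt_decaying phi decay_constant
  by unfold_locales (fact continuous_on_phi abs_phi_le_sqrt)+

lemma phi_has_real_derivative:
  assumes x: "x \<in> reciprocal_gap n"
  shows "(phi has_real_derivative lam * kerK_op_deriv n x) (at x)"
proof (rule has_field_derivative_transform_within_open[OF _ _ x])
  show "((\<lambda>x. lam * kerK_op phi x) has_real_derivative lam * kerK_op_deriv n x) (at x)"
    by (intro DERIV_cmult kerK_op_has_real_derivative x)
  show "open (reciprocal_gap n)"
    by (simp add: reciprocal_gap_def)
  show "lam * kerK_op phi t = phi t" if "t \<in> reciprocal_gap n" for t
    using reciprocal_gapD[OF that] by (simp add: phi_eq)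
qed

lemma deriv_phi_eq: "x \<in> reciprocal_gap n \<Longrightarrow> deriv phi x = lam * kerK_op_deriv n x"
  by (intro DERIV_imp_deriv phi_has_real_derivative)

lemma
  assumes x: "0 < x" "x < 1" "1 / x \<notin> \<int>"
  shows phi_differentiable: "phi differentiable (at x)"
    and summable_if_not_reciprocal:
      "summable (\<lambda>m. if real m > 1 / x then phi (1 / (real m * x)) / real m else 0)"
    and deriv_phi_formula: "inverse lam * x\<^sup>2 * deriv phi x
        = reciprocal_moment - (\<Sum>m. if real m > 1 / x then phi (1 / (real m * x)) / real m else 0)"
proof -
  obtain n where n: "x \<in> reciprocal_gap n"
    using x by (rule ex_reciprocal_gap)
  have "real m > 1 / x \<longleftrightarrow> m \<ge> n + 1" for m
    using reciprocal_gapD(3,4)[OF n] by auto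
  then have tail: "(\<lambda>m. if real m > 1 / x then phi (1 / (real m * x)) / real m else 0)
      = (\<lambda>m. tail_term n m x)"
    by (simp add: tail_term_def)
  show "phi differentiable (at x)"
    using phi_has_real_derivative[OF n] by (auto simp: real_differentiable_def)
  show "summable (\<lambda>m. if real m > 1 / x then phi (1 / (real m * x)) / real m else 0)"
    unfolding tail using n by (intro summable_tail_term) (simp add: reciprocal_gap_def)
  show "inverse lam * x\<^sup>2 * deriv phi x
      = reciprocal_moment - (\<Sum>m. if real m > 1 / x then phi (1 / (real m * x)) / real m else 0)"
    unfolding tail deriv_phi_eq[OF n] kerK_op_deriv_def using x lam_nonzero by simp
qed

lemma
  assumes n: "n \<ge> 1"
  shows continuous_on_deriv_phi: "continuous_on {1 / real (n + 1)<..<1 / real n} (deriv phi)"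
    and deriv_phi_at_left:
      "(deriv phi \<longlongrightarrow> lam * kerK_op_deriv n (1 / real n)) (at_left (1 / real n))"
    and deriv_phi_at_right:
      "(deriv phi \<longlongrightarrow> lam * kerK_op_deriv n (1 / real (n + 1))) (at_right (1 / real (n + 1)))"
proof -
  let ?a = "1 / real (n + 1)" and ?b = "1 / real n" and ?D = "\<lambda>x. lam * kerK_op_deriv n x"
  have ab: "?a < ?b"
    using n by (simp add: field_simps)
  have deriv_eq: "?D x = deriv phi x" if "x \<in> {?a<..<?b}" for x
    using that deriv_phi_eq by (simp add: reciprocal_gap_def)
  have cont: "continuous_on {?a..?b} ?D"
    by (intro continuous_intros continuous_on_subset[OF continuous_on_kerK_op_deriv]) auto
  then have "continuous_on {?a<..<?b} ?D"
    by (rule continuous_on_subset) auto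
  then show "continuous_on {?a<..<?b} (deriv phi)"
    using deriv_eq by (rule continuous_on_eq)
  show "(deriv phi \<longlongrightarrow> ?D ?b) (at_left ?b)"
    using continuous_on_Icc_at_leftD[OF cont ab]
      eventually_mono[OF eventually_at_left_real[OF ab] deriv_eq]
    by (rule Lim_transform_eventually)
  show "(deriv phi \<longlongrightarrow> ?D ?a) (at_right ?a)"
    using continuous_on_Icc_at_rightD[OF cont ab]
      eventually_mono[OF eventually_at_right_real[OF ab] deriv_eq]
    by (rule Lim_transform_eventually)
qed

lemma lam_mult_kerK_op_deriv_reciprocal:
  "lam * kerK_op_deriv n (1 / real k) = lam * (real k)\<^sup>2 *
    (reciprocal_moment - (\<Sum>m. if m \<ge> n + 1 then phi (real k / real m) / real m else 0))"
  unfolding kerK_op_deriv_def tail_term_reciprocal by (simp add: power_one_over)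

lemma summable_tail_reciprocal:
  assumes "1 \<le> k" "k \<le> n + 1"
  shows "summable (\<lambda>m. if m \<ge> n + 1 then phi (real k / real m) / real m else 0)"
  unfolding tail_term_reciprocal[symmetric] using assms by (intro summable_tail_term frac_le) auto

end

theorem theorem4p1:
  fixes phis :: "nat \<Rightarrow> real \<Rightarrow> real" and lams :: "nat \<Rightarrow> real" and j :: nat
  assumes sys: "eigen_system phis lams" and j: "j \<ge> 1"
  defines "ph \<equiv> phis j" and "lm \<equiv> lams j"
  defines "Phi1 \<equiv> (LINT y:{0..1}|lebesgue. ph y / y)"
  shows "set_integrable lebesgue {0..1} (\<lambda>y. ph y / y)
    \<and> (\<forall>x. 0 < x \<and> x < 1 \<and> 1 / x \<notin> \<int> \<longrightarrow>
          ph differentiable (at x)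
          \<and> summable (\<lambda>m::nat. if real m > 1 / x then ph (1 / (real m * x)) / real m else 0)
          \<and> inverse lm * x\<^sup>2 * deriv ph x
              = Phi1 - (\<Sum>m. if real m > 1 / x then ph (1 / (real m * x)) / real m else 0))
    \<and> (\<forall>n::nat. n \<ge> 1 \<longrightarrow>
          continuous_on {1 / real (n + 1)<..<1 / real n} (deriv ph)
          \<and> summable (\<lambda>m::nat. if m \<ge> n + 1 then ph (real n / real m) / real m else 0)
          \<and> summable (\<lambda>m::nat. if m \<ge> n + 1 then ph (real (n + 1) / real m) / real m else 0)
          \<and> (deriv ph \<longlongrightarrow> lm * (real n)\<^sup>2 * (Phi1 -
               (\<Sum>m. if m \<ge> n + 1 then ph (real n / real m) / real m else 0)))
              (at_left (1 / real n))
          \<and> (deriv ph \<longlongrightarrow> lm * (real (n + 1))\<^sup>2 * (Phi1 -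
               (\<Sum>m. if m \<ge> n + 1 then ph (real (n + 1) / real m) / real m else 0)))
              (at_right (1 / real (n + 1))))"
proof -
  have "eigenfun ph lm"
    using sys j by (simp add: eigen_system_def ph_def lm_def)
  then interpret kerK_eigenfunction ph lm
    by unfold_locales
  have Phi1: "Phi1 = reciprocal_moment"
    by (simp add: Phi1_def reciprocal_moment_def)
  show ?thesis
    unfolding Phi1
    by (intro conjI allI impI; (elim conjE)?)
       (rule set_integrable_f_divide phi_differentiable summable_if_not_reciprocal deriv_phi_formula
          continuous_on_deriv_phi summable_tail_reciprocal
          deriv_phi_at_left[unfolded lam_mult_kerK_op_deriv_reciprocal]
          deriv_phi_at_right[unfolded lam_mult_kerK_op_deriv_reciprocal]; simp)+
qed

end
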